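(* Two structures $\mathbb A,\mathbb B$ satisfy $\mathrm{qPol}^{\mathrm{no}}(\mathbb A)\subseteq\mathrm{qPol}^{\mathrm{no}}(\mathbb B)$ if, and only if, $\mathbb A$ q-no-defines $\mathbb B$.
   Context: Structures: a signature $\sigma$ is a finite set of relation symbols $R$ with arities $\mathrm{ar}(R)\ge 1$; a $\sigma$-structure $\mathbb A$ consists of a finite domain $A$ and relations $R^{\mathbb A}\subseteq A^{\mathrm{ar}(R)}$ for $R\in\sigma$. All structures are finite; $\mathbb A$ and $\mathbb B$ may have different signatures. $\mathrm{Gaif}(\mathbb A)$ is the loopless undirected graph on $A$ in which distinct $x,y$ are adjacent iff they occur together in some tuple of some relation of $\mathbb A$. For $n\ge 1$, the power $\mathbb A^n$ has domain $A^n$, and $(\mathbf b_1,\dots,\mathbf b_r)\in R^{\mathbb A^n}$ iff for every $i\in[n]$ the tuple of $i$-th coordinates lies in $R^{\mathbb A}$. For $S\subseteq A^r$, $(A;S)$ is the structure with domain $A$ and the single relation $S$. Quantum homomorphisms: a PVM on a Hilbert space $H$ with outcome set $B$ is a family $(Q_b)_{b\in B}$ of operators with $Q_b=Q_b^*=Q_b^2$ and $\sum_b Q_b=\mathrm{id}$. A quantum function $Q$ from $A$ to $B$ is a family of PVMs $(Q_{a,b})_{b\in B}$, one for each $a\in A$, all over the same non-trivial finite-dimensional Hilbert space. For $\sigma$-structures $\mathbb A,\mathbb B$ and a quantum function $Q$ from $A$ to $B$ consider: (QH1) $Q_{a_1,b_1}Q_{a_2,b_2}\cdots Q_{a_r,b_r}=0$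 (product in this order) for all $R\in\sigma$ of arity $r$, $\mathbf a\in R^{\mathbb A}$, $\mathbf b\in B^{r}\setminus R^{\mathbb B}$; (QH2) $Q_{a,b}Q_{a',b'}=Q_{a',b'}Q_{a,b}$ for all $\{a,a'\}\in E(\mathrm{Gaif}(\mathbb A))$ and $b,b'\in B$. $Q$ is a non-oracular quantum homomorphism $\mathbb A\to_{qno}\mathbb B$ if (QH1) holds, and a quantum homomorphism $\mathbb A\to_q\mathbb B$ if (QH1) and (QH2) hold. $\mathrm{qPol}^{\mathrm{no}}(\mathbb A)$ is the set of all non-oracular quantum homomorphisms $\mathbb A^n\to_{qno}\mathbb A$, $n\ge1$ (each regarded as a quantum function from $A^n$ to $A$). Let $\mathbb A$ be a $\sigma$-structure and $S\subseteq A^r$. Let $\mathbb R$ be the structure with domain $[r]$ and a single $r$-ary relation $\{(1,\dots,r)\}$ (in the signature of $(A;S)$). A non-oracular q-definition of $S$ in $\mathbb A$ is a $\sigma$-structure $\mathbb G$ with distinguished vertices $g_1,\dots,g_r$ (not necessarily distinct) such that (noq1) for every quantum homomorphism $Q:\mathbb R\to_q(A;S)$ there is a non-oracular quantum homomorphism $Q':\mathbb G\to_{qno}\mathbb A$ with $Q'_{g_i,a}=Q_{i,a}$ for all $i\in[r]$, $a\in A$; (noq2) for every non-oracular quantum homomorphism $Q:\mathbb G\to_{qno}\mathbb A$, the quantum function $Q'_{i,a}:=Q_{g_i,a}$ is a non-oracular quantum homomorphism $\mathbb R\to_{qno}(A;S)$. $\mathbb A$ q-no-defines $\mathbb B$ if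 $\mathbb A$ and $\mathbb B$ have the same domain and every relation of $\mathbb B$ has a non-oracular q-definition in $\mathbb A$.
   Formalization: The direction from inclusion to q-no-definability is proved only when every relation of B is non-empty; it fails otherwise, e.g. for A = ({0}; no relations) and B = ({0}; empty unary relation). The converse direction is proved without this assumption. *)

theory Defs
  imports "HOL-Library.FuncSet" "Jordan_Normal_Form.Schur_Decomposition"
begin

record 's signature =
  syms :: "'s set"
  arity :: "'s \<Rightarrow> nat"

definition is_signature :: "'s signature \<Rightarrow> bool" where
  "is_signature \<sigma> \<longleftrightarrow> finite (syms \<sigma>) \<and> (\<forall>R\<in>syms \<sigma>. 1 \<le> arity \<sigma> R)"

definition tuples :: "nat \<Rightarrow> 'a set \<Rightarrow> 'a list set" where
  "tuples n A = {xs. length xs = n \<and> set xs \<subseteq> A}"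

record ('s, 'a) rel_structure =
  domain :: "'a set"
  rel :: "'s \<Rightarrow> 'a list set"

definition is_structure :: "'s signature \<Rightarrow> ('s, 'a) rel_structure \<Rightarrow> bool" where
  "is_structure \<sigma> A \<longleftrightarrow>
     finite (domain A) \<and> (\<forall>R\<in>syms \<sigma>. rel A R \<subseteq> tuples (arity \<sigma> R) (domain A))"

definition gaif_edges :: "'s signature \<Rightarrow> ('s, 'a) rel_structure \<Rightarrow> 'a set set" where
  "gaif_edges \<sigma> A =
     {{x, y} | x y. x \<noteq> y \<and> (\<exists>R\<in>syms \<sigma>. \<exists>t\<in>rel A R. x \<in> set t \<and> y \<in> set t)}"

definition struct_power :: "'s signature \<Rightarrow> nat \<Rightarrow> ('s, 'a) rel_structure \<Rightarrow> ('s, 'a list) rel_structure" where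
  "struct_power \<sigma> n A =
     \<lparr>domain = tuples n (domain A),
      rel = (\<lambda>R. {bs \<in> tuples (arity \<sigma> R) (tuples n (domain A)).
                    \<forall>i<n. map (\<lambda>b. b ! i) bs \<in> rel A R})\<rparr>"

definition single_sig :: "nat \<Rightarrow> unit signature" where
  "single_sig r = \<lparr>syms = {()}, arity = (\<lambda>_. r)\<rparr>"

definition single_struct :: "'a set \<Rightarrow> 'a list set \<Rightarrow> (unit, 'a) rel_structure" where
  "single_struct A S = \<lparr>domain = A, rel = (\<lambda>_. S)\<rparr>"

definition tuple_struct :: "nat \<Rightarrow> (unit, nat) rel_structure" where
  "tuple_struct r = single_struct {1..r} {[1..<Suc r]}"

text \<open>Up to unitary isomorphism, the non-trivial finite-dimensional Hilbert spaces are the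
  spaces of complex column vectors of length d with d > 0; their operators are the complex
  d by d matrices.\<close>

definition is_PVM :: "nat \<Rightarrow> 'b set \<Rightarrow> ('b \<Rightarrow> complex mat) \<Rightarrow> bool" where
  "is_PVM d B P \<longleftrightarrow>
     (\<forall>b\<in>B. P b \<in> carrier_mat d d \<and> mat_adjoint (P b) = P b \<and> P b * P b = P b) \<and>
     finsum (ring_mat TYPE(complex) d ()) P B = 1\<^sub>m d"

record ('a, 'b) qfun =
  source :: "'a set"
  target :: "'b set"
  hdim :: nat
  qop :: "'a \<Rightarrow> 'b \<Rightarrow> complex mat"

text \<open>Operators are extensional, so that equality of quantum functions is equality of the
  indexed families; source, target and Hilbert space are part of a quantum function.\<close>

definition quantum_function :: "'a set \<Rightarrow> 'b set \<Rightarrow> ('a, 'b) qfun \<Rightarrow> bool" where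
  "quantum_function A B Q \<longleftrightarrow>
     source Q = A \<and> target Q = B \<and> 0 < hdim Q \<and>
     qop Q \<in> (\<Pi>\<^sub>E a\<in>A. \<Pi>\<^sub>E b\<in>B. carrier_mat (hdim Q) (hdim Q)) \<and>
     (\<forall>a\<in>A. is_PVM (hdim Q) B (qop Q a))"

definition qprod :: "('a, 'b) qfun \<Rightarrow> 'a list \<Rightarrow> 'b list \<Rightarrow> complex mat" where
  "qprod Q as bs = foldr (*) (map2 (qop Q) as bs) (1\<^sub>m (hdim Q))"

definition QH1 :: "'s signature \<Rightarrow> ('s, 'a) rel_structure \<Rightarrow> ('s, 'b) rel_structure \<Rightarrow> ('a, 'b) qfun \<Rightarrow> bool" where
  "QH1 \<sigma> A B Q \<longleftrightarrow>
     (\<forall>R\<in>syms \<sigma>. \<forall>as\<in>rel A R. \<forall>bs \<in> tuples (arity \<sigma> R) (domain B) - rel B R.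
        qprod Q as bs = 0\<^sub>m (hdim Q) (hdim Q))"

definition QH2 :: "'s signature \<Rightarrow> ('s, 'a) rel_structure \<Rightarrow> ('s, 'b) rel_structure \<Rightarrow> ('a, 'b) qfun \<Rightarrow> bool" where
  "QH2 \<sigma> A B Q \<longleftrightarrow>
     (\<forall>a a'. {a, a'} \<in> gaif_edges \<sigma> A \<longrightarrow>
        (\<forall>b\<in>domain B. \<forall>b'\<in>domain B. qop Q a b * qop Q a' b' = qop Q a' b' * qop Q a b))"

definition qno_hom :: "'s signature \<Rightarrow> ('s, 'a) rel_structure \<Rightarrow> ('s, 'b) rel_structure \<Rightarrow> ('a, 'b) qfun \<Rightarrow> bool" where
  "qno_hom \<sigma> A B Q \<longleftrightarrow> quantum_function (domain A) (domain B) Q \<and> QH1 \<sigma> A B Q"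

definition q_hom :: "'s signature \<Rightarrow> ('s, 'a) rel_structure \<Rightarrow> ('s, 'b) rel_structure \<Rightarrow> ('a, 'b) qfun \<Rightarrow> bool" where
  "q_hom \<sigma> A B Q \<longleftrightarrow>
     quantum_function (domain A) (domain B) Q \<and> QH1 \<sigma> A B Q \<and> QH2 \<sigma> A B Q"

definition qPol_no :: "'s signature \<Rightarrow> ('s, 'a) rel_structure \<Rightarrow> ('a list, 'a) qfun set" where
  "qPol_no \<sigma> A = {Q. \<exists>n\<ge>1. qno_hom \<sigma> (struct_power \<sigma> n A) A Q}"

definition qfun_pullback :: "nat \<Rightarrow> (nat \<Rightarrow> 'g) \<Rightarrow> ('g, 'a) qfun \<Rightarrow> (nat, 'a) qfun" where
  "qfun_pullback r g Q =
     \<lparr>source = {1..r}, target = target Q, hdim = hdim Q,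
      qop = (\<lambda>i\<in>{1..r}. qop Q (g i))\<rparr>"

definition qno_definition ::
  "'s signature \<Rightarrow> ('s, 'a) rel_structure \<Rightarrow> nat \<Rightarrow> 'a list set \<Rightarrow>
   ('s, 'g) rel_structure \<Rightarrow> (nat \<Rightarrow> 'g) \<Rightarrow> bool" where
  "qno_definition \<sigma> A r S G g \<longleftrightarrow>
     is_structure \<sigma> G \<and> (\<forall>i\<in>{1..r}. g i \<in> domain G) \<and>
     (\<forall>Q. q_hom (single_sig r) (tuple_struct r) (single_struct (domain A) S) Q \<longrightarrow>
        (\<exists>Q'. qno_hom \<sigma> G A Q' \<and>
              (\<forall>i\<in>{1..r}. \<forall>a\<in>domain A. qop Q' (g i) a = qop Q i a))) \<and>
     (\<forall>Q. qno_hom \<sigma> G A Q \<longrightarrow>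
        qno_hom (single_sig r) (tuple_struct r) (single_struct (domain A) S)
          (qfun_pullback r g Q))"

text \<open>The vertices of the gadget are natural numbers without loss of generality, since gadgets
  are finite.\<close>

definition qno_defines ::
  "'s signature \<Rightarrow> ('s, 'a) rel_structure \<Rightarrow> 't signature \<Rightarrow> ('t, 'a) rel_structure \<Rightarrow> bool" where
  "qno_defines \<sigma> A \<tau> B \<longleftrightarrow>
     domain A = domain B \<and>
     (\<forall>R\<in>syms \<tau>. \<exists>(G :: ('s, nat) rel_structure) g.
        qno_definition \<sigma> A (arity \<tau> R) (rel B R) G g)"

end

(*
  If the gadgets exist, each row of a tuple of B^n is a one-dimensional quantum homomorphism
  to (A; S); (noq1) extends it to a one-dimensional, hence classical, homomorphism from the
  gadget G to A. The n rows together give a homomorphism G -> A^n, along which a quantum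
  polymorphism of A can be pulled back, and (noq2) yields (QH1) for B.

  Conversely, the gadget for S = {s_1, ..., s_m} is A^m with g_j = (s_1(j), ..., s_m(j)).
  (noq2) is (QH1) for quantum polymorphisms of B of arity m. For (noq1), the commuting PVMs
  of Q have a joint PVM with outcomes in S; measuring it and, on outcome s_k, applying the
  k-th projection A^m -> A is the required quantum homomorphism.
*)
theory Submission
  imports Defs
begin

section \<open>Sums and products of square matrices\<close>

text \<open>A non-oracular quantum homomorphism gives no commutation, so QH1 is transported between
  structures only by precomposition with classical homomorphisms. Commuting operators are needed for
  (noq1) alone, and there QH2 supplies them: the source has one tuple, which contains every vertex.
  The joint measurement is handled without a common eigenbasis. Two matrices are equal once they
  agree after right multiplication by each projection of some PVM, and on such a projection every
  operator that occurs acts as the scalar 0 or 1. This rests on orthogonality of distinct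
  projections, which a PVM is not assumed to have and which follows from the sum being the identity.
  (noq1) does not mention the dimension of the extension; it is read off from the size of one shared
  matrix. Nonempty relations of B matter in one direction: for empty S the gadget would be A^0,
  while polymorphisms have arity at least 1. If A is a point without relations and B the same point
  with an empty unary relation, the inclusion holds, yet every structure maps to A and no gadget
  exists.\<close>

declare mult_carrier_mat[of _ d d _ d for d, simp]

lemma times_index:
  fixes X Y :: "complex mat"
  assumes "X \<in> carrier_mat d d" "Y \<in> carrier_mat d d" "i < d" "j < d"
  shows "(X * Y) $$ (i, j) = (\<Sum>l<d. X $$ (i, l) * Y $$ (l, j))"
  using assms by (simp add: scalar_prod_def lessThan_atLeast0)

text \<open>Entrywise sums turn identities about sums of operators into identities of complex sums;
  \<open>finsum_ring_mat\<close> links them to the sum in the definition of a PVM.\<close>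

definition mat_sum :: "nat \<Rightarrow> ('k \<Rightarrow> complex mat) \<Rightarrow> 'k set \<Rightarrow> complex mat" where
  "mat_sum d F K = mat d d (\<lambda>(i, j). \<Sum>k\<in>K. F k $$ (i, j))"

lemma mat_sum_carrier [simp]: "mat_sum d F K \<in> carrier_mat d d"
  by (simp add: mat_sum_def)

lemma mat_sum_dim [simp]: "dim_row (mat_sum d F K) = d" "dim_col (mat_sum d F K) = d"
  by (simp_all add: mat_sum_def)

lemma index_mat_sum [simp]:
  "i < d \<Longrightarrow> j < d \<Longrightarrow> mat_sum d F K $$ (i, j) = (\<Sum>k\<in>K. F k $$ (i, j))"
  by (simp add: mat_sum_def)

lemma mat_sum_cong: "(\<And>k. k \<in> K \<Longrightarrow> F k = G k) \<Longrightarrow> mat_sum d F K = mat_sum d G K"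
  by (simp add: mat_sum_def)

lemma finsum_ring_mat:
  assumes "finite K" "\<And>k. k \<in> K \<Longrightarrow> F k \<in> carrier_mat d d"
  shows "finsum (ring_mat TYPE(complex) d ()) F K = mat_sum d F K"
proof -
  interpret ring "ring_mat TYPE(complex) d ()" by (rule ring_mat)
  show ?thesis using assms
  proof (induction K)
    case empty
    show ?case by (auto simp: ring_mat_simps)
  next
    case (insert x K)
    then have "finsum (ring_mat TYPE(complex) d ()) F (insert x K) = F x + mat_sum d F K"
      by (subst finsum_insert) (auto simp: ring_mat_simps)
    also have "\<dots> = mat_sum d F (insert x K)"
      using insert.hyps insert.prems[of x] by (intro eq_matI) auto
    finally show ?case .
  qed
qed

lemma mult_mat_sum:
  assumes X: "X \<in> carrier_mat d d" and F: "\<And>k. k \<in> K \<Longrightarrow> F k \<in> carrier_mat d d"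
  shows "X * mat_sum d F K = mat_sum d (\<lambda>k. X * F k) K"
proof (rule eq_matI)
  fix i j assume "i < dim_row (mat_sum d (\<lambda>k. X * F k) K)" "j < dim_col (mat_sum d (\<lambda>k. X * F k) K)"
  then have ij: "i < d" "j < d" by auto
  have "(X * mat_sum d F K) $$ (i, j) = (\<Sum>l<d. X $$ (i, l) * (\<Sum>k\<in>K. F k $$ (l, j)))"
    using X ij by (simp add: scalar_prod_def lessThan_atLeast0)
  also have "\<dots> = (\<Sum>k\<in>K. \<Sum>l<d. X $$ (i, l) * F k $$ (l, j))"
    by (simp add: sum_distrib_left sum.swap[of _ "{..<d}"])
  also have "\<dots> = (\<Sum>k\<in>K. (X * F k) $$ (i, j))"
  proof (rule sum.cong[OF refl])
    fix k assume "k \<in> K"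
    from F[OF this] show "(\<Sum>l<d. X $$ (i, l) * F k $$ (l, j)) = (X * F k) $$ (i, j)"
      using X ij by (simp add: scalar_prod_def lessThan_atLeast0)
  qed
  finally show "(X * mat_sum d F K) $$ (i, j) = mat_sum d (\<lambda>k. X * F k) K $$ (i, j)"
    using ij by simp
qed (use X in auto)

lemma mat_sum_mult:
  assumes X: "X \<in> carrier_mat d d" and F: "\<And>k. k \<in> K \<Longrightarrow> F k \<in> carrier_mat d d"
  shows "mat_sum d F K * X = mat_sum d (\<lambda>k. F k * X) K"
proof (rule eq_matI)
  fix i j assume "i < dim_row (mat_sum d (\<lambda>k. F k * X) K)" "j < dim_col (mat_sum d (\<lambda>k. F k * X) K)"
  then have ij: "i < d" "j < d" by auto
  have "(mat_sum d F K * X) $$ (i, j) = (\<Sum>l<d. (\<Sum>k\<in>K. F k $$ (i, l)) * X $$ (l, j))"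
    using X ij by (simp add: scalar_prod_def lessThan_atLeast0)
  also have "\<dots> = (\<Sum>k\<in>K. \<Sum>l<d. F k $$ (i, l) * X $$ (l, j))"
    by (simp add: sum_distrib_right sum.swap[of _ "{..<d}"])
  also have "\<dots> = (\<Sum>k\<in>K. (F k * X) $$ (i, j))"
  proof (rule sum.cong[OF refl])
    fix k assume "k \<in> K"
    from F[OF this] show "(\<Sum>l<d. F k $$ (i, l) * X $$ (l, j)) = (F k * X) $$ (i, j)"
      using X ij by (simp add: scalar_prod_def lessThan_atLeast0)
  qed
  finally show "(mat_sum d F K * X) $$ (i, j) = mat_sum d (\<lambda>k. F k * X) K $$ (i, j)"
    using ij by simp
qed (use X in auto)

lemma mat_sum_Sigma:
  assumes "finite K" "\<And>k. k \<in> K \<Longrightarrow> finite (L k)"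
  shows "mat_sum d (\<lambda>k. mat_sum d (F k) (L k)) K = mat_sum d (\<lambda>(k, l). F k l) (Sigma K L)"
  using assms by (intro eq_matI) (auto simp: sum.Sigma case_prod_unfold)

lemma mat_sum_reindex_bij_betw:
  assumes "bij_betw h K L"
  shows "mat_sum d (\<lambda>k. F (h k)) K = mat_sum d F L"
  using sum.reindex_bij_betw[OF assms] by (intro eq_matI) auto

lemma mat_sum_mono_neutral:
  assumes "finite L" "K \<subseteq> L" "\<And>k. k \<in> L - K \<Longrightarrow> F k = 0\<^sub>m d d"
  shows "mat_sum d F K = mat_sum d F L"
proof (intro eq_matI)
  fix i j assume "i < dim_row (mat_sum d F L)" "j < dim_col (mat_sum d F L)"
  then show "mat_sum d F K $$ (i, j) = mat_sum d F L $$ (i, j)"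
    using assms by (auto intro!: sum.mono_neutral_left)
qed auto

lemma mat_sum_delta:
  assumes "finite K" "X \<in> carrier_mat d d"
  shows "mat_sum d (\<lambda>k. of_bool (k = l) \<cdot>\<^sub>m X) K = of_bool (l \<in> K) \<cdot>\<^sub>m X"
  proof (rule eq_matI)
  fix i j assume ij: "i < dim_row (of_bool (l \<in> K) \<cdot>\<^sub>m X)" "j < dim_col (of_bool (l \<in> K) \<cdot>\<^sub>m X)"
  have "mat_sum d (\<lambda>k. of_bool (k = l) \<cdot>\<^sub>m X) K $$ (i, j) = (\<Sum>k\<in>K. if k = l then X $$ (i, j) else 0)"
    using ij assms(2) by (auto intro!: sum.cong)
  also have "\<dots> = (of_bool (l \<in> K) \<cdot>\<^sub>m X) $$ (i, j)"
    using ij assms by (simp add: sum.delta)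
  finally show "mat_sum d (\<lambda>k. of_bool (k = l) \<cdot>\<^sub>m X) K $$ (i, j) = (of_bool (l \<in> K) \<cdot>\<^sub>m X) $$ (i, j)" .
qed (use assms in auto)

section \<open>Adjoints\<close>

lemma mat_adjoint_dim [simp]:
  "dim_row (mat_adjoint X) = dim_col X" "dim_col (mat_adjoint X) = dim_row X"
  by (simp_all add: mat_adjoint_def mat_of_rows_def)

lemma mat_adjoint_carrier [simp]: "X \<in> carrier_mat m n \<Longrightarrow> mat_adjoint X \<in> carrier_mat n m"
  by (auto intro!: carrier_matI)

lemma index_mat_adjoint:
  assumes "X \<in> carrier_mat m n" "i < n" "j < m"
  shows "mat_adjoint X $$ (i, j) = conjugate (X $$ (j, i))"
  using assms by (auto simp: mat_adjoint_def mat_of_rows_def)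

lemma mat_adjoint_mult:
  assumes "X \<in> carrier_mat d d" "Y \<in> carrier_mat d d"
  shows "mat_adjoint (X * Y) = mat_adjoint Y * (mat_adjoint X :: complex mat)"
proof (rule eq_matI)
  fix i j assume "i < dim_row (mat_adjoint Y * mat_adjoint X)" "j < dim_col (mat_adjoint Y * mat_adjoint X)"
  then have ij: "i < d" "j < d" using assms by auto
  have c: "mat_adjoint X \<in> carrier_mat d d" "mat_adjoint Y \<in> carrier_mat d d" using assms by auto
  have "mat_adjoint (X * Y) $$ (i, j) = conjugate (\<Sum>l<d. X $$ (j, l) * Y $$ (l, i))"
    using assms ij by (subst index_mat_adjoint[of _ d d]) (auto simp: scalar_prod_def lessThan_atLeast0)
  also have "\<dots> = (\<Sum>l<d. mat_adjoint Y $$ (i, l) * mat_adjoint X $$ (l, j))"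
    using assms ij by (auto simp: index_mat_adjoint[of _ d d] mult.commute intro!: sum.cong)
  also have "\<dots> = (mat_adjoint Y * mat_adjoint X) $$ (i, j)"
    using times_index[OF c(2,1) ij] by simp
  finally show "mat_adjoint (X * Y) $$ (i, j) = (mat_adjoint Y * mat_adjoint X) $$ (i, j)" .
qed (use assms in auto)

lemma mat_adjoint_one: "mat_adjoint (1\<^sub>m d :: complex mat) = 1\<^sub>m d"
  by (intro eq_matI) (auto simp: index_mat_adjoint[of _ d d])

lemma mat_adjoint_zero: "mat_adjoint (0\<^sub>m d d :: complex mat) = 0\<^sub>m d d"
  by (intro eq_matI) (auto simp: index_mat_adjoint[of _ d d])

lemma mat_adjoint_mat_sum:
  assumes "\<And>k. k \<in> K \<Longrightarrow> F k \<in> carrier_mat d d"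
  shows "mat_adjoint (mat_sum d F K) = mat_sum d (\<lambda>k. mat_adjoint (F k)) K"
proof (rule eq_matI)
  fix i j assume "i < dim_row (mat_sum d (\<lambda>k. mat_adjoint (F k)) K)" "j < dim_col (mat_sum d (\<lambda>k. mat_adjoint (F k)) K)"
  then show "mat_adjoint (mat_sum d F K) $$ (i, j) = mat_sum d (\<lambda>k. mat_adjoint (F k)) K $$ (i, j)"
    using assms by (auto simp: index_mat_adjoint[of _ d d] intro!: sum.cong)
qed auto

section \<open>Projection-valued measures\<close>

lemma is_PVM_iff_mat_sum:
  assumes "finite B"
  shows "is_PVM d B P \<longleftrightarrow>
    (\<forall>b\<in>B. P b \<in> carrier_mat d d \<and> mat_adjoint (P b) = P b \<and> P b * P b = P b) \<and>
    mat_sum d P B = 1\<^sub>m d"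
  using finsum_ring_mat[OF assms, of P d] by (auto simp: is_PVM_def)

text \<open>Sandwiching the identity as a sum of the projections \<open>P c\<close> between two copies of \<open>P a\<close>
  gives \<open>P a\<close> plus the positive matrices \<open>(P c * P a)\<^sup>* * (P c * P a)\<close> for \<open>c \<noteq> a\<close>; so the
  diagonals of the latter vanish.\<close>

lemma PVM_orthogonal:
  assumes P: "is_PVM d B P" and "finite B" and ab: "a \<in> B" "b \<in> B" "a \<noteq> b"
  shows "P b * P a = 0\<^sub>m d d"
proof -
  have car: "\<And>c. c \<in> B \<Longrightarrow> P c \<in> carrier_mat d d"
    and adj: "\<And>c. c \<in> B \<Longrightarrow> mat_adjoint (P c) = P c"
    and idem: "\<And>c. c \<in> B \<Longrightarrow> P c * P c = P c"
    and sum1: "mat_sum d P B = 1\<^sub>m d"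
    using P \<open>finite B\<close> by (auto simp: is_PVM_iff_mat_sum)
  \<comment> \<open>The squared Euclidean norm of column i of \<open>P c * P a\<close>. Being real
    and nonnegative, these numbers vanish one by one as soon as their sum over c does.\<close>
  define N where "N c i = (\<Sum>l<d. (cmod ((P c * P a) $$ (l, i)))\<^sup>2)" for c i
  have diag: "(P a * (P c * P a)) $$ (i, i) = complex_of_real (N c i)" if "c \<in> B" "i < d" for c i
  proof -
    have M: "P c * P a \<in> carrier_mat d d" using car[OF \<open>c \<in> B\<close>] car[OF ab(1)] by simp
    have "P a * (P c * P a) = P a * ((P c * P c) * P a)"
      by (simp add: idem[OF \<open>c \<in> B\<close>])
    also have "\<dots> = (P a * P c) * (P c * P a)"
      using car[OF \<open>c \<in> B\<close>] car[OF ab(1)] by (simp add: assoc_mult_mat[of _ d d _ d _ d])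
    also have "P a * P c = mat_adjoint (P c * P a)"
      using car[OF \<open>c \<in> B\<close>] car[OF ab(1)] by (simp add: mat_adjoint_mult[of _ d] adj that ab)
    finally have "(P a * (P c * P a)) $$ (i, i) = (\<Sum>l<d. mat_adjoint (P c * P a) $$ (i, l) * (P c * P a) $$ (l, i))"
      using times_index[OF mat_adjoint_carrier[OF M] M] that by simp
    also have "\<dots> = complex_of_real (N c i)"
      unfolding N_def of_real_sum
      by (rule sum.cong[OF refl])
        (use that in \<open>simp add: index_mat_adjoint[OF M] complex_norm_square[symmetric] mult.commute[of "cnj _"] del: index_mult_mat(1) of_real_power\<close>)
    finally show ?thesis .
  qed
  have *: "mat_sum d (\<lambda>c. P a * (P c * P a)) B = P a"
  proof -
    have "mat_sum d (\<lambda>c. P a * (P c * P a)) B = P a * mat_sum d (\<lambda>c. P c * P a) B"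
      using car ab by (intro mult_mat_sum[symmetric]) auto
    also have "mat_sum d (\<lambda>c. P c * P a) B = mat_sum d P B * P a"
      using car ab by (intro mat_sum_mult[symmetric]) auto
    finally show ?thesis using car[OF ab(1)] by (simp add: sum1 idem ab)
  qed
  have aa: "P a * (P a * P a) = P a" by (simp add: idem ab)
  have "(\<Sum>c\<in>B. complex_of_real (N c i)) = complex_of_real (N a i)" if "i < d" for i
  proof -
    have "(\<Sum>c\<in>B. complex_of_real (N c i)) = mat_sum d (\<lambda>c. P a * (P c * P a)) B $$ (i, i)"
      using that by (simp add: diag del: index_mult_mat(1))
    then show ?thesis using diag[OF ab(1) that] by (simp add: * aa)
  qed
  then have "(\<Sum>c\<in>B. N c i) = N a i" if "i < d" for i
    using that by (metis of_real_eq_iff of_real_sum)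
  then have sum0: "(\<Sum>c\<in>B - {a}. N c i) = 0" if "i < d" for i
    using that sum.remove[OF \<open>finite B\<close> ab(1), of "\<lambda>c. N c i"] by simp
  have N0: "N b i = 0" if "i < d" for i
    using sum0[OF that] ab \<open>finite B\<close> sum_nonneg_eq_0_iff[of "B - {a}" "\<lambda>c. N c i"]
    by (auto simp: N_def sum_nonneg simp del: index_mult_mat(1))
  have 0: "(P b * P a) $$ (l, i) = 0" if "i < d" "l < d" for i l
    using N0[OF that(1)] that(2) unfolding N_def
    by (subst (asm) sum_nonneg_eq_0_iff) (auto simp del: index_mult_mat(1))
  show ?thesis
  proof (rule eq_matI)
    show "(P b * P a) $$ (i, j) = 0\<^sub>m d d $$ (i, j)" if "i < dim_row (0\<^sub>m d d)" "j < dim_col (0\<^sub>m d d)" for i j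
      using 0[of j i] that by (simp del: index_mult_mat(1))
  qed (use car[OF ab(1)] car[OF ab(2)] in simp_all)
qed

section \<open>Ordered products of matrices\<close>

lemma foldr_mult_carrier:
  assumes "\<And>X. X \<in> set Xs \<Longrightarrow> X \<in> carrier_mat d d"
  shows "foldr (*) Xs (1\<^sub>m d :: complex mat) \<in> carrier_mat d d"
  using assms by (induction Xs) (auto intro!: mult_carrier_mat[of _ d d])

lemma foldr_mult_zero:
  assumes "\<And>X. X \<in> set Xs \<Longrightarrow> X \<in> carrier_mat d d" "0\<^sub>m d d \<in> set Xs"
  shows "foldr (*) Xs (1\<^sub>m d :: complex mat) = 0\<^sub>m d d"
  using assms
proof (induction Xs)
  case (Cons X Xs)
  have "X \<in> carrier_mat d d" "foldr (*) Xs (1\<^sub>m d) \<in> carrier_mat d d"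
    using Cons.prems foldr_mult_carrier[of Xs d] by auto
  then show ?case using Cons by (auto simp: right_mult_zero_mat)
qed simp

lemma commute_foldr_mult:
  assumes "\<And>X. X \<in> set Xs \<Longrightarrow> X \<in> carrier_mat d d" "Y \<in> carrier_mat d d"
    "\<And>X. X \<in> set Xs \<Longrightarrow> Y * X = X * Y"
  shows "Y * foldr (*) Xs (1\<^sub>m d :: complex mat) = foldr (*) Xs (1\<^sub>m d) * Y"
  using assms
proof (induction Xs)
  case (Cons X Xs)
  let ?Z = "foldr (*) Xs (1\<^sub>m d)"
  have Z: "?Z \<in> carrier_mat d d" "X \<in> carrier_mat d d" using foldr_mult_carrier[of Xs d] Cons.prems by auto
  have "Y * (X * ?Z) = (Y * X) * ?Z" using Z Cons.prems(2) by (simp add: assoc_mult_mat[of _ d d _ d _ d])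
  also have "\<dots> = X * (Y * ?Z)" using Z Cons.prems(2) Cons.prems(3)[of X] by (simp add: assoc_mult_mat[of _ d d _ d _ d])
  also have "Y * ?Z = ?Z * Y" using Cons by auto
  finally show ?case using Z Cons.prems(2) by (simp add: assoc_mult_mat[of _ d d _ d _ d])
qed simp

text \<open>Y is moved to the right past the factors, with all of which it commutes, until it meets
  one on which it acts as the scalar c.\<close>

lemma mult_foldr_mult_absorb:
  assumes "\<And>X. X \<in> set Xs \<Longrightarrow> X \<in> carrier_mat d d" "Y \<in> carrier_mat d d"
    "\<And>X. X \<in> set Xs \<Longrightarrow> Y * X = X * Y"
    and "\<exists>X\<in>set Xs. Y * X = c \<cdot>\<^sub>m X"
  shows "Y * foldr (*) Xs (1\<^sub>m d :: complex mat) = c \<cdot>\<^sub>m foldr (*) Xs (1\<^sub>m d)"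
  using assms
proof (induction Xs)
  case (Cons X Xs)
  let ?Z = "foldr (*) Xs (1\<^sub>m d)"
  have Z: "?Z \<in> carrier_mat d d" "X \<in> carrier_mat d d" using foldr_mult_carrier[of Xs d] Cons.prems by auto
  have YX: "Y * (X * ?Z) = (Y * X) * ?Z" using Z Cons.prems(2) by (simp add: assoc_mult_mat[of _ d d _ d _ d])
  show ?case
  proof (cases "Y * X = c \<cdot>\<^sub>m X")
    case True
    then show ?thesis using YX Z by (simp add: mult_smult_assoc_mat[of _ d d _ d])
  next
    case False
    then have IH: "Y * ?Z = c \<cdot>\<^sub>m ?Z" using Cons by auto
    have "(Y * X) * ?Z = X * (Y * ?Z)" using Z Cons.prems(2) Cons.prems(3)[of X] by (simp add: assoc_mult_mat[of _ d d _ d _ d])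
    then show ?thesis using YX Z by (simp add: IH mult_smult_distrib[of _ d d _ d])
  qed
qed simp

text \<open>The adjoint reverses the order of the product, and commutation restores it.\<close>

lemma mat_adjoint_foldr_mult:
  assumes "\<And>X. X \<in> set Xs \<Longrightarrow> X \<in> carrier_mat d d" "\<And>X. X \<in> set Xs \<Longrightarrow> mat_adjoint X = X"
    "\<And>X Y. X \<in> set Xs \<Longrightarrow> Y \<in> set Xs \<Longrightarrow> X * Y = Y * X"
  shows "mat_adjoint (foldr (*) Xs (1\<^sub>m d :: complex mat)) = foldr (*) Xs (1\<^sub>m d)"
  using assms
proof (induction Xs)
  case Nil
  show ?case by (simp add: mat_adjoint_one)
next
  case (Cons X Xs)
  have "mat_adjoint (X * foldr (*) Xs (1\<^sub>m d)) = foldr (*) Xs (1\<^sub>m d) * X"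
    using Cons foldr_mult_carrier[of Xs d] by (simp add: mat_adjoint_mult[of _ d])
  also have "\<dots> = X * foldr (*) Xs (1\<^sub>m d)"
    using Cons.prems by (intro commute_foldr_mult[symmetric]) auto
  finally show ?case by simp
qed

lemma finite_tuples [simp]: "finite A \<Longrightarrow> finite (tuples n A)"
  using finite_lists_length_eq[of A n] by (simp add: tuples_def conj_commute)

text \<open>This is the product of the identities \<open>mat_sum d (P x) A = 1\<^sub>m d\<close>
  multiplied out. Only distributivity is used, so the PVMs need not commute here.\<close>

lemma mat_sum_foldr_mult_tuples:
  assumes "finite A" "\<And>x. x \<in> set xs \<Longrightarrow> is_PVM d A (P x)"
  shows "mat_sum d (\<lambda>s. foldr (*) (map2 P xs s) (1\<^sub>m d)) (tuples (length xs) A) = 1\<^sub>m d"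
  using assms(2)
proof (induction xs)
  case Nil
  have "tuples 0 A = {[]}" by (auto simp: tuples_def)
  then show ?case by (intro eq_matI) auto
next
  case (Cons x xs)
  let ?T = "tuples (length xs) A"
  let ?F = "\<lambda>s. foldr (*) (map2 P xs s) (1\<^sub>m d)"
  have car: "P y b \<in> carrier_mat d d" if "y \<in> set (x # xs)" "b \<in> A" for y b
    using Cons.prems[OF that(1)] that(2) by (auto simp: is_PVM_def)
  have F: "?F s \<in> carrier_mat d d" if "s \<in> ?T" for s
    using that car by (intro foldr_mult_carrier) (auto simp: tuples_def dest: set_zip_leftD set_zip_rightD)
  have bij: "bij_betw (\<lambda>(a, s). a # s) (A \<times> ?T) (tuples (length (x # xs)) A)"
    by (rule bij_betw_byWitness[where f' = "\<lambda>s. (hd s, tl s)"])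
      (auto simp: tuples_def length_Suc_conv)
  have "mat_sum d (\<lambda>s. foldr (*) (map2 P (x # xs) s) (1\<^sub>m d)) (tuples (length (x # xs)) A) =
    mat_sum d (\<lambda>(a, s). P x a * ?F s) (A \<times> ?T)"
    unfolding mat_sum_reindex_bij_betw[OF bij, symmetric] by (rule mat_sum_cong) auto
  also have "\<dots> = mat_sum d (\<lambda>a. mat_sum d (\<lambda>s. P x a * ?F s) ?T) A"
    using assms(1) by (subst mat_sum_Sigma) auto
  also have "\<dots> = mat_sum d (\<lambda>a. P x a * mat_sum d ?F ?T) A"
    using F by (intro mat_sum_cong mult_mat_sum[symmetric] car) simp_all
  also have "\<dots> = mat_sum d (P x) A"
    using Cons by (intro mat_sum_cong) (simp add: right_mult_one_mat[OF car])
  also have "\<dots> = 1\<^sub>m d"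
    using Cons.prems[of x] assms(1) by (simp add: is_PVM_iff_mat_sum)
  finally show ?case .
qed

lemma smult_zero_mat: "(0 :: complex) \<cdot>\<^sub>m X = 0\<^sub>m (dim_row X) (dim_col X)"
  by (intro eq_matI) auto

lemma one_smult_mat [simp]: "(1 :: complex) \<cdot>\<^sub>m X = X"
  by (intro eq_matI) auto

text \<open>Idempotence and orthogonality in one equation; the 0/1 scalar avoids case distinctions
  in all later computations.\<close>

lemma PVM_mult:
  assumes "is_PVM d K E" "finite K" "k \<in> K" "l \<in> K"
  shows "E k * E l = of_bool (k = l) \<cdot>\<^sub>m E l"
proof -
  have "E l \<in> carrier_mat d d" "E l * E l = E l" using assms by (auto simp: is_PVM_def)
  then show ?thesis using PVM_orthogonal[OF assms(1,2,4,3)]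
    by (cases "k = l") auto
qed

text \<open>Multiply by the identity, written as the sum of the \<open>E k\<close>. This is the
  substitute for comparing operators on a basis.\<close>

lemma PVM_ext:
  assumes "is_PVM d K E" "finite K" "X \<in> carrier_mat d d" "Y \<in> carrier_mat d d"
    and "\<And>k. k \<in> K \<Longrightarrow> X * E k = Y * E k"
  shows "X = Y"
proof -
  have E: "\<And>k. k \<in> K \<Longrightarrow> E k \<in> carrier_mat d d" and 1: "mat_sum d E K = 1\<^sub>m d"
    using assms(1,2) by (auto simp: is_PVM_iff_mat_sum)
  have "X = X * mat_sum d E K" using assms(3) by (simp add: 1)
  also have "\<dots> = Y * mat_sum d E K" using assms(5)
    by (simp add: mult_mat_sum[OF assms(3) E] mult_mat_sum[OF assms(4) E] cong: mat_sum_cong)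
  also have "\<dots> = Y" using assms(4) by (simp add: 1)
  finally show ?thesis .
qed

section \<open>Classical processing of measurement outcomes\<close>

text \<open>The push-forward of the PVM E along f: measure E and report f of the outcome. With f a
  coordinate it is a marginal.\<close>

definition coarse_graining ::
    "nat \<Rightarrow> 'k set \<Rightarrow> ('k \<Rightarrow> complex mat) \<Rightarrow> ('k \<Rightarrow> 'b) \<Rightarrow> 'b \<Rightarrow> complex mat" where
  "coarse_graining d K E f b = mat_sum d E {k \<in> K. f k = b}"

lemma coarse_graining_carrier [simp]: "coarse_graining d K E f b \<in> carrier_mat d d"
  by (simp add: coarse_graining_def)

lemma coarse_graining_mult:
  assumes E: "is_PVM d K E" and "finite K" "k \<in> K"
  shows "coarse_graining d K E f b * E k = of_bool (f k = b) \<cdot>\<^sub>m E k"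
proof -
  have car: "E l \<in> carrier_mat d d" if "l \<in> K" for l using E that by (auto simp: is_PVM_def)
  have "coarse_graining d K E f b * E k = mat_sum d (\<lambda>l. E l * E k) {l \<in> K. f l = b}"
    unfolding coarse_graining_def using car assms(3) by (intro mat_sum_mult) auto
  also have "\<dots> = mat_sum d (\<lambda>l. of_bool (l = k) \<cdot>\<^sub>m E k) {l \<in> K. f l = b}"
    using PVM_mult[OF E assms(2) _ assms(3)] by (intro mat_sum_cong) auto
  also have "\<dots> = of_bool (f k = b) \<cdot>\<^sub>m E k"
    using assms car by (subst mat_sum_delta) auto
  finally show ?thesis .
qed

text \<open>On the range of \<open>E k\<close> each push-forward is deterministic with value
  \<open>f k\<close>, so a product of them, in any order and of any length, acts there as 0 or
  1.\<close>

lemma foldr_coarse_graining_mult: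
  assumes E: "is_PVM d K E" and "finite K" "k \<in> K"
  shows "foldr (*) (map (\<lambda>(f, b). coarse_graining d K E f b) fbs) (1\<^sub>m d) * E k =
    of_bool (\<forall>(f, b)\<in>set fbs. f k = b) \<cdot>\<^sub>m E k"
proof (induction fbs)
  case Nil
  have "E k \<in> carrier_mat d d" using assms by (auto simp: is_PVM_def)
  then show ?case by simp
next
  case (Cons fb fbs)
  obtain f b where fb: "fb = (f, b)" by fastforce
  have car: "E k \<in> carrier_mat d d" using assms by (auto simp: is_PVM_def)
  let ?Z = "foldr (*) (map (\<lambda>(f, b). coarse_graining d K E f b) fbs) (1\<^sub>m d)"
  have Z: "?Z \<in> carrier_mat d d" by (intro foldr_mult_carrier) auto
  have "coarse_graining d K E f b * ?Z * E k = coarse_graining d K E f b * (?Z * E k)"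
    using car Z by (intro assoc_mult_mat[of _ d d _ d _ d]) auto
  also have "\<dots> = of_bool (\<forall>(f, b)\<in>set fbs. f k = b) \<cdot>\<^sub>m (of_bool (f k = b) \<cdot>\<^sub>m E k)"
    using coarse_graining_mult[OF assms, of f b] car
    by (simp only: Cons.IH) (simp add: mult_smult_distrib[of _ d d _ d])
  also have "\<dots> = of_bool (\<forall>(f, b)\<in>set (fb # fbs). f k = b) \<cdot>\<^sub>m E k"
    using car by (auto simp: fb smult_zero_mat)
  finally show ?case by (simp add: fb)
qed

text \<open>Idempotence is checked on each \<open>E k\<close>, where the operator is 0 or 1. The sum
  is the identity because the fibres of f over B partition K.\<close>

lemma is_PVM_coarse_graining:
  assumes E: "is_PVM d K E" and "finite K" "finite B" and f: "f \<in> K \<rightarrow> B"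
  shows "is_PVM d B (coarse_graining d K E f)"
  unfolding is_PVM_iff_mat_sum[OF \<open>finite B\<close>]
proof (intro conjI ballI)
  note mult = coarse_graining_mult[OF E \<open>finite K\<close>]
  have car: "E k \<in> carrier_mat d d" if "k \<in> K" for k using E that by (auto simp: is_PVM_def)
  fix b assume "b \<in> B"
  show "coarse_graining d K E f b \<in> carrier_mat d d" by simp
  have "mat_adjoint (E k) = E k" if "k \<in> K" for k using E that by (auto simp: is_PVM_def)
  then show "mat_adjoint (coarse_graining d K E f b) = coarse_graining d K E f b"
    unfolding coarse_graining_def using car
    by (subst mat_adjoint_mat_sum) (auto intro: mat_sum_cong)
  show "coarse_graining d K E f b * coarse_graining d K E f b = coarse_graining d K E f b"
  proof (rule PVM_ext[OF E \<open>finite K\<close>])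
    fix k assume k: "k \<in> K"
    have "coarse_graining d K E f b * coarse_graining d K E f b * E k =
      coarse_graining d K E f b * (coarse_graining d K E f b * E k)"
      using car[OF k] by (intro assoc_mult_mat[of _ d d _ d _ d]) simp_all
    also have "\<dots> = of_bool (f k = b) \<cdot>\<^sub>m (of_bool (f k = b) \<cdot>\<^sub>m E k)"
      using car[OF k] by (simp add: mult k mult_smult_distrib[of _ d d _ d])
    also have "\<dots> = coarse_graining d K E f b * E k"
      using car[OF k] by (auto simp: mult k smult_zero_mat)
    finally show "coarse_graining d K E f b * coarse_graining d K E f b * E k =
      coarse_graining d K E f b * E k" .
  qed simp_all
next
  have "mat_sum d (coarse_graining d K E f) B =
    mat_sum d (\<lambda>(b, k). E k) (SIGMA b:B. {k \<in> K. f k = b})"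
    unfolding coarse_graining_def using assms(2,3) by (intro mat_sum_Sigma) auto
  also have "\<dots> = mat_sum d E K"
  proof -
    have "bij_betw snd (SIGMA b:B. {k \<in> K. f k = b}) K"
      by (rule bij_betw_byWitness[where f' = "\<lambda>k. (f k, k)"]) (use f in auto)
    from mat_sum_reindex_bij_betw[OF this] show ?thesis by (simp add: case_prod_unfold)
  qed
  also have "\<dots> = 1\<^sub>m d" using E assms(2) by (simp add: is_PVM_iff_mat_sum)
  finally show "mat_sum d (coarse_graining d K E f) B = 1\<^sub>m d" .
qed

section \<open>Joint measurement of commuting PVMs\<close>

definition joint_PVM :: "nat \<Rightarrow> ('i \<Rightarrow> 'a \<Rightarrow> complex mat) \<Rightarrow> 'i list \<Rightarrow> 'a list \<Rightarrow> complex mat" where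
  "joint_PVM d P xs s = foldr (*) (map2 P xs s) (1\<^sub>m d)"

context
  fixes d :: nat and A :: "'a set" and P :: "'i \<Rightarrow> 'a \<Rightarrow> complex mat" and xs :: "'i list"
  assumes finA: "finite A" and P: "\<And>x. x \<in> set xs \<Longrightarrow> is_PVM d A (P x)"
    and comm: "\<And>x y a b. x \<in> set xs \<Longrightarrow> y \<in> set xs \<Longrightarrow> a \<in> A \<Longrightarrow> b \<in> A \<Longrightarrow>
      P x a * P y b = P y b * P x a"
begin

lemma joint_factor_E:
  assumes "X \<in> set (map2 P xs s)" "s \<in> tuples n A"
  obtains x a where "x \<in> set xs" "a \<in> A" "X = P x a"
  using assms by (auto simp: tuples_def dest: set_zip_leftD set_zip_rightD)

lemma factor_carrier: "x \<in> set xs \<Longrightarrow> a \<in> A \<Longrightarrow> P x a \<in> carrier_mat d d"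
  using P by (auto simp: is_PVM_def)

lemma joint_PVM_carrier: "s \<in> tuples n A \<Longrightarrow> joint_PVM d P xs s \<in> carrier_mat d d"
  unfolding joint_PVM_def by (rule foldr_mult_carrier) (metis joint_factor_E factor_carrier)

text \<open>The product for s contains the factor \<open>P (xs ! j) (s ! j)\<close>, which
  \<open>P (xs ! j) a\<close> fixes or annihilates by orthogonality. So the joint outcome s
  determines the outcome of every single measurement.\<close>

lemma factor_mult_joint:
  assumes s: "s \<in> tuples (length xs) A" and j: "j < length xs" and a: "a \<in> A"
  shows "P (xs ! j) a * joint_PVM d P xs s = of_bool (s ! j = a) \<cdot>\<^sub>m joint_PVM d P xs s"
  unfolding joint_PVM_def
proof (rule mult_foldr_mult_absorb)
  have x: "xs ! j \<in> set xs" using j by simp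
  have sj: "s ! j \<in> A" using s j by (auto simp: tuples_def)
  have "map2 P xs s ! j = P (xs ! j) (s ! j)" "j < length (map2 P xs s)"
    using s j by (auto simp: tuples_def)
  then have "P (xs ! j) (s ! j) \<in> set (map2 P xs s)" by (metis nth_mem)
  moreover have "P (xs ! j) a * P (xs ! j) (s ! j) = of_bool (s ! j = a) \<cdot>\<^sub>m P (xs ! j) (s ! j)"
    using PVM_mult[OF P[OF x] finA a sj] by (simp add: eq_commute)
  ultimately show "\<exists>X\<in>set (map2 P xs s). P (xs ! j) a * X = of_bool (s ! j = a) \<cdot>\<^sub>m X" by blast
  show "P (xs ! j) a \<in> carrier_mat d d" using factor_carrier[OF x a] .
  fix X assume "X \<in> set (map2 P xs s)"
  then obtain y b where "y \<in> set xs" "b \<in> A" "X = P y b" using joint_factor_E s by metis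
  then show "X \<in> carrier_mat d d" "P (xs ! j) a * X = X * P (xs ! j) a"
    using factor_carrier comm[OF x _ a] by auto
qed

lemma is_PVM_joint_PVM: "is_PVM d (tuples (length xs) A) (joint_PVM d P xs)"
  unfolding is_PVM_iff_mat_sum[OF finite_tuples[OF finA]]
proof (intro conjI ballI)
  show "mat_sum d (joint_PVM d P xs) (tuples (length xs) A) = 1\<^sub>m d"
    unfolding joint_PVM_def using finA P by (rule mat_sum_foldr_mult_tuples)
  fix s assume s: "s \<in> tuples (length xs) A"
  let ?J = "joint_PVM d P xs s"
  show J: "?J \<in> carrier_mat d d" using s by (rule joint_PVM_carrier)
  show "mat_adjoint ?J = ?J" unfolding joint_PVM_def
  proof (rule mat_adjoint_foldr_mult)
    fix X assume "X \<in> set (map2 P xs s)"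
    then obtain y b where yb: "y \<in> set xs" "b \<in> A" "X = P y b" using joint_factor_E s by metis
    then show "X \<in> carrier_mat d d" "mat_adjoint X = X" using P[OF yb(1)] by (auto simp: is_PVM_def)
    fix Y assume "Y \<in> set (map2 P xs s)"
    then obtain z c where "z \<in> set xs" "c \<in> A" "Y = P z c" using joint_factor_E s by metis
    then show "X * Y = Y * X" using yb comm by auto
  qed
  have absorb: "X * ?J = ?J" if X: "X \<in> set (map2 P xs s)" for X
  proof -
    obtain j where j: "j < length xs" "X = P (xs ! j) (s ! j)"
      using X s by (auto simp: in_set_conv_nth tuples_def)
    then have "s ! j \<in> A" using s by (auto simp: tuples_def)
    from factor_mult_joint[OF s j(1) this] show ?thesis using J by (simp add: j)
  qed
  \<comment> \<open>Idempotence is proved for an arbitrary list of factors of \<open>?J\<close>, so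
    that the left product can shrink in the induction while \<open>?J\<close> stays whole.\<close>
  have "foldr (*) Xs (1\<^sub>m d) * ?J = ?J" if "set Xs \<subseteq> set (map2 P xs s)" for Xs
    using that
  proof (induction Xs)
    case Nil
    show ?case using J by simp
  next
    case (Cons X Xs)
    have "Y \<in> carrier_mat d d" if "Y \<in> set (X # Xs)" for Y
      using Cons.prems that joint_factor_E[OF _ s] factor_carrier by (metis subsetD)
    then have "X \<in> carrier_mat d d" "foldr (*) Xs (1\<^sub>m d) \<in> carrier_mat d d"
      by (auto intro: foldr_mult_carrier)
    then have "X * foldr (*) Xs (1\<^sub>m d) * ?J = X * (foldr (*) Xs (1\<^sub>m d) * ?J)"
      using J by (intro assoc_mult_mat)
    then show ?case using Cons absorb[of X] by simp
  qed
  from this[OF subset_refl] show "?J * ?J = ?J" by (simp add: joint_PVM_def)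
qed

text \<open>Outcomes with zero projection contribute nothing to the sum. Discarding them leaves
  outcomes in S only, each of which can then select a homomorphism.\<close>

lemma is_PVM_joint_PVM_supported:
  assumes "S \<subseteq> tuples (length xs) A"
    and "\<And>s. s \<in> tuples (length xs) A - S \<Longrightarrow> joint_PVM d P xs s = 0\<^sub>m d d"
  shows "is_PVM d S (joint_PVM d P xs)"
proof -
  have fin: "finite (tuples (length xs) A)" "finite S"
    using finA assms(1) by (auto intro: finite_subset)
  then show ?thesis
    using is_PVM_joint_PVM mat_sum_mono_neutral[OF fin(1) assms] assms(1)
    by (auto simp: is_PVM_iff_mat_sum)
qed

text \<open>The j-th marginal is the original measurement: on each joint outcome s both sides act as
  the same 0/1 scalar, given by \<open>s ! j = a\<close>.\<close>

lemma coarse_graining_joint_PVM: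
  assumes S: "S \<subseteq> tuples (length xs) A" and PVM: "is_PVM d S (joint_PVM d P xs)"
    and j: "j < length xs" and a: "a \<in> A"
  shows "coarse_graining d S (joint_PVM d P xs) (\<lambda>s. s ! j) a = P (xs ! j) a"
proof -
  have fin: "finite S" using finA S by (auto intro: finite_subset)
  show ?thesis
  proof (rule PVM_ext[OF PVM fin])
    show "P (xs ! j) a \<in> carrier_mat d d" using j a by (intro factor_carrier) auto
    show "coarse_graining d S (joint_PVM d P xs) (\<lambda>s. s ! j) a * joint_PVM d P xs s =
      P (xs ! j) a * joint_PVM d P xs s" if "s \<in> S" for s
      unfolding coarse_graining_mult[OF PVM fin that] factor_mult_joint[OF subsetD[OF S that] j a] ..
  qed simp
qed

end

section \<open>Quantum functions\<close>

definition struct_hom ::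
    "'s signature \<Rightarrow> ('s, 'a) rel_structure \<Rightarrow> ('s, 'b) rel_structure \<Rightarrow> ('a \<Rightarrow> 'b) \<Rightarrow> bool" where
  "struct_hom \<sigma> A B h \<longleftrightarrow> h \<in> domain A \<rightarrow> domain B \<and>
     (\<forall>R\<in>syms \<sigma>. \<forall>t\<in>rel A R. map h t \<in> rel B R)"

definition qfun_comp :: "'a set \<Rightarrow> ('a \<Rightarrow> 'g) \<Rightarrow> ('g, 'b) qfun \<Rightarrow> ('a, 'b) qfun" where
  "qfun_comp A h Q =
     \<lparr>source = A, target = target Q, hdim = hdim Q, qop = (\<lambda>a\<in>A. qop Q (h a))\<rparr>"

lemma qfun_pullback_eq_comp: "qfun_pullback r g Q = qfun_comp {1..r} g Q"
  by (simp add: qfun_pullback_def qfun_comp_def)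

lemma quantum_function_comp:
  assumes "quantum_function A' B Q" "h \<in> A \<rightarrow> A'"
  shows "quantum_function A B (qfun_comp A h Q)"
  using assms by (auto simp: quantum_function_def qfun_comp_def Pi_iff PiE_iff)

lemma qprod_comp:
  assumes "set as \<subseteq> A"
  shows "qprod (qfun_comp A h Q) as bs = qprod Q (map h as) bs"
proof -
  have "map2 (qop (qfun_comp A h Q)) as bs = map2 (qop Q) (map h as) bs"
    using assms by (induction as bs rule: list_induct2') (auto simp: qfun_comp_def)
  then show ?thesis by (simp add: qprod_def qfun_comp_def)
qed

lemma rel_subset_domain:
  "is_structure \<sigma> A \<Longrightarrow> R \<in> syms \<sigma> \<Longrightarrow> t \<in> rel A R \<Longrightarrow> set t \<subseteq> domain A \<and> length t = arity \<sigma> R"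
  by (auto simp: is_structure_def tuples_def)

text \<open>The image of a tuple of G is a tuple of G', so each product required to vanish is
  already among those that vanish for Q.\<close>

lemma qno_hom_comp:
  assumes "is_structure \<sigma> G" "struct_hom \<sigma> G G' h" "qno_hom \<sigma> G' A Q"
  shows "qno_hom \<sigma> G A (qfun_comp (domain G) h Q)"
  using assms quantum_function_comp[of "domain G'" "domain A" Q h "domain G"]
  by (auto simp: qno_hom_def QH1_def struct_hom_def qprod_comp rel_subset_domain)
    (auto simp: qfun_comp_def)

section \<open>Dimension one: quantum functions as ordinary functions\<close>

definition classical_qfun :: "'a set \<Rightarrow> 'b set \<Rightarrow> ('a \<Rightarrow> 'b) \<Rightarrow> ('a, 'b) qfun" where
  "classical_qfun A B h =
     \<lparr>source = A, target = B, hdim = 1, qop = (\<lambda>a\<in>A. \<lambda>b\<in>B. of_bool (h a = b) \<cdot>\<^sub>m 1\<^sub>m 1)\<rparr>"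

lemma quantum_function_classical:
  assumes "finite B" "h \<in> A \<rightarrow> B"
  shows "quantum_function A B (classical_qfun A B h)"
proof -
  have "is_PVM 1 B (\<lambda>b\<in>B. of_bool (h a = b) \<cdot>\<^sub>m 1\<^sub>m 1)" if "a \<in> A" for a
    unfolding is_PVM_iff_mat_sum[OF assms(1)]
  proof (intro conjI ballI)
    have "mat_sum 1 (\<lambda>b\<in>B. of_bool (h a = b) \<cdot>\<^sub>m 1\<^sub>m 1) B = mat_sum 1 (\<lambda>b. of_bool (b = h a) \<cdot>\<^sub>m 1\<^sub>m 1) B"
      by (rule mat_sum_cong) (simp add: eq_commute)
    also have "\<dots> = 1\<^sub>m 1"
      using assms \<open>a \<in> A\<close> by (subst mat_sum_delta) (auto simp: Pi_iff)
    finally show "mat_sum 1 (\<lambda>b\<in>B. of_bool (h a = b) \<cdot>\<^sub>m 1\<^sub>m 1) B = 1\<^sub>m 1" .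
  qed (auto simp: smult_zero_mat mat_adjoint_one mat_adjoint_zero)
  then show ?thesis
    by (auto simp: quantum_function_def classical_qfun_def)
qed

text \<open>A position where bs differs from \<open>map h as\<close> contributes a zero
  factor.\<close>

lemma qprod_classical:
  assumes "set as \<subseteq> A" "set bs \<subseteq> B" "length bs = length as" "bs \<noteq> map h as"
  shows "qprod (classical_qfun A B h) as bs = 0\<^sub>m 1 1"
proof -
  obtain j where j: "j < length as" "h (as ! j) \<noteq> bs ! j"
    using assms(3,4) by (metis length_map nth_equalityI nth_map)
  then have m: "as ! j \<in> A" "bs ! j \<in> B" using assms by auto
  let ?Xs = "map2 (qop (classical_qfun A B h)) as bs"
  have "?Xs ! j = 0\<^sub>m 1 1" "j < length ?Xs"
    using j m assms(3) by (auto simp: classical_qfun_def smult_zero_mat)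
  then have "0\<^sub>m 1 1 \<in> set ?Xs" by (metis nth_mem)
  moreover have "X \<in> carrier_mat 1 1" if X: "X \<in> set ?Xs" for X
  proof -
    obtain a b where "(a, b) \<in> set (zip as bs)" "X = qop (classical_qfun A B h) a b"
      using X by auto
    then show ?thesis using assms(1,2)
      by (auto simp: classical_qfun_def dest: subsetD[OF _ set_zip_leftD] subsetD[OF _ set_zip_rightD])
  qed
  ultimately have "foldr (*) ?Xs (1\<^sub>m 1) = 0\<^sub>m 1 1"
    by (intro foldr_mult_zero) auto
  then show ?thesis by (simp add: qprod_def classical_qfun_def)
qed

lemma q_hom_classical:
  assumes "is_structure \<sigma> G" "is_structure \<sigma> A" "struct_hom \<sigma> G A h"
  shows "q_hom \<sigma> G A (classical_qfun (domain G) (domain A) h)"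
proof -
  let ?Q = "classical_qfun (domain G) (domain A) h"
  have "quantum_function (domain G) (domain A) ?Q"
    using assms by (intro quantum_function_classical) (auto simp: is_structure_def struct_hom_def)
  moreover have "QH1 \<sigma> G A ?Q" unfolding QH1_def
  proof (intro ballI)
    fix R as bs assume *: "R \<in> syms \<sigma>" "as \<in> rel G R" "bs \<in> tuples (arity \<sigma> R) (domain A) - rel A R"
    then have "bs \<noteq> map h as" using assms(3) by (auto simp: struct_hom_def)
    then have "qprod ?Q as bs = 0\<^sub>m 1 1"
      using * rel_subset_domain[OF assms(1) *(1,2)] by (intro qprod_classical) (auto simp: tuples_def)
    then show "qprod ?Q as bs = 0\<^sub>m (hdim ?Q) (hdim ?Q)" by (simp add: classical_qfun_def)
  qed
  \<comment> \<open>Outside the domain the extensional operators are undefined, so the endpoints of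
    an edge have to be placed in it before scalars can be commuted.\<close>
  moreover have "a \<in> domain G \<and> a' \<in> domain G" if "{a, a'} \<in> gaif_edges \<sigma> G" for a a'
    using that rel_subset_domain[OF assms(1)] by (fastforce simp: gaif_edges_def doubleton_eq_iff)
  then have "QH2 \<sigma> G A ?Q" unfolding QH2_def
    by (auto simp: classical_qfun_def smult_zero_mat insert_commute of_bool_def)
  ultimately show ?thesis by (simp add: q_hom_def)
qed

text \<open>A 1 by 1 idempotent is 0 or 1, and since the operators at v sum to 1, some outcome has
  operator 1; it is taken as \<open>h v\<close>. If h broke a tuple, the product along its image
  would be 1 as well as 0 by QH1.\<close>

lemma qno_hom_dim1_classical:
  assumes "is_structure \<sigma> G" "finite (domain A)" and Q: "qno_hom \<sigma> G A Q" and "hdim Q = 1"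
  obtains h where "struct_hom \<sigma> G A h" "\<And>v. v \<in> domain G \<Longrightarrow> qop Q v (h v) = 1\<^sub>m 1"
proof -
  have PVM: "is_PVM 1 (domain A) (qop Q v)" if "v \<in> domain G" for v
    using Q that \<open>hdim Q = 1\<close> by (auto simp: qno_hom_def quantum_function_def)
  have dichotomy: "X = 0\<^sub>m 1 1 \<or> X = 1\<^sub>m 1" if "X \<in> carrier_mat 1 1" "X * X = X" for X :: "complex mat"
  proof -
    have "X $$ (0, 0) * X $$ (0, 0) = X $$ (0, 0)"
      using that times_index[of X 1 X 0 0] by simp
    then have "X $$ (0, 0) = 0 \<or> X $$ (0, 0) = 1" by simp
    then show ?thesis using that(1) by (auto intro!: eq_matI)
  qed
  have "\<exists>a\<in>domain A. qop Q v a = 1\<^sub>m 1" if v: "v \<in> domain G" for v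
  proof (rule ccontr)
    assume "\<not> ?thesis"
    then have "qop Q v a = 0\<^sub>m 1 1" if "a \<in> domain A" for a
      using that dichotomy PVM[OF v] by (auto simp: is_PVM_def)
    then have "mat_sum 1 (qop Q v) (domain A) $$ (0, 0) = 0" by simp
    also have "mat_sum 1 (qop Q v) (domain A) = 1\<^sub>m 1"
      using PVM[OF v] assms(2) by (simp add: is_PVM_iff_mat_sum)
    finally show False by simp
  qed
  then obtain h where h: "\<And>v. v \<in> domain G \<Longrightarrow> h v \<in> domain A \<and> qop Q v (h v) = 1\<^sub>m 1"
    by metis
  have "map h t \<in> rel A R" if R: "R \<in> syms \<sigma>" and t: "t \<in> rel G R" for R t
  proof (rule ccontr)
    note dom = rel_subset_domain[OF assms(1) R t]
    assume "map h t \<notin> rel A R"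
    moreover have "map h t \<in> tuples (arity \<sigma> R) (domain A)"
      using dom h by (auto simp: tuples_def)
    ultimately have "qprod Q t (map h t) = 0\<^sub>m 1 1"
      using Q R t \<open>hdim Q = 1\<close> by (auto simp: qno_hom_def QH1_def)
    moreover have "qprod Q t (map h t) = 1\<^sub>m 1"
      using dom[THEN conjunct1] h \<open>hdim Q = 1\<close> by (induction t) (auto simp: qprod_def)
    ultimately have "(0\<^sub>m 1 1 :: complex mat) $$ (0, 0) = 1\<^sub>m 1 $$ (0, 0)" by simp
    then show False by simp
  qed
  then show ?thesis using h that[of h] by (auto simp: struct_hom_def)
qed

section \<open>Powers and the one-tuple structure\<close>

lemma is_structure_power:
  "is_structure \<sigma> A \<Longrightarrow> is_structure \<sigma> (struct_power \<sigma> n A)"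
  by (auto simp: is_structure_def struct_power_def)

text \<open>The universal property of the power: n homomorphisms into A combine into one into its
  n-th power.\<close>

lemma struct_hom_power:
  assumes G: "is_structure \<sigma> G" and h: "\<And>i. i < n \<Longrightarrow> struct_hom \<sigma> G A (h i)"
  shows "struct_hom \<sigma> G (struct_power \<sigma> n A) (\<lambda>v. map (\<lambda>i. h i v) [0..<n])"
proof -
  let ?H = "\<lambda>v. map (\<lambda>i. h i v) [0..<n]"
  have H: "?H v \<in> tuples n (domain A)" if "v \<in> domain G" for v
    using that h by (auto simp: tuples_def struct_hom_def Pi_iff)
  have "map ?H t \<in> rel (struct_power \<sigma> n A) R" if R: "R \<in> syms \<sigma>" and t: "t \<in> rel G R" for R t
  proof -
    have "map ?H t \<in> tuples (arity \<sigma> R) (tuples n (domain A))"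
      using H rel_subset_domain[OF G R t] by (auto simp: tuples_def[of "arity \<sigma> R"])
    moreover have "map (\<lambda>b. b ! i) (map ?H t) \<in> rel A R" if "i < n" for i
      using h[OF that] R t that by (simp add: struct_hom_def comp_def)
    ultimately show ?thesis by (simp add: struct_power_def)
  qed
  then show ?thesis using H by (auto simp: struct_hom_def struct_power_def)
qed

lemma is_structure_tuple_struct: "is_structure (single_sig r) (tuple_struct r)"
  by (auto simp: is_structure_def single_sig_def tuple_struct_def single_struct_def tuples_def)

lemma is_structure_single_struct:
  "finite A \<Longrightarrow> S \<subseteq> tuples r A \<Longrightarrow> is_structure (single_sig r) (single_struct A S)"
  by (simp add: is_structure_def single_sig_def single_struct_def)

text \<open>Tuples of S are the homomorphisms from the one-tuple structure. Its vertices count from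
  1 and list positions from 0, hence \<open>j - 1\<close>.\<close>

lemma struct_hom_tuple_struct:
  assumes "s \<in> S" "S \<subseteq> tuples r A"
  shows "struct_hom (single_sig r) (tuple_struct r) (single_struct A S) (\<lambda>j. s ! (j - 1))"
proof -
  have s: "length s = r" "set s \<subseteq> A" using assms by (auto simp: tuples_def)
  have "map (\<lambda>j. s ! (j - 1)) [1..<Suc r] = s"
    using s(1) by (intro nth_equalityI) (auto simp del: upt_Suc)
  moreover have "s ! (j - 1) \<in> A" if "j \<in> {1..r}" for j
    using that s nth_mem[of "j - 1" s] by auto
  ultimately show ?thesis using assms(1)
    by (auto simp: struct_hom_def tuple_struct_def single_struct_def single_sig_def simp del: upt_Suc)
qed

section \<open>From gadgets to inclusion of polymorphisms\<close>

lemma qPol_subset_if_qno_defines: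
  fixes \<sigma> :: "'s signature"
  assumes \<tau>: "is_signature \<tau>" and A: "is_structure \<sigma> A" and B: "is_structure \<tau> B"
    and def: "qno_defines \<sigma> A \<tau> B"
  shows "qPol_no \<sigma> A \<subseteq> qPol_no \<tau> B"
proof
  fix Q assume "Q \<in> qPol_no \<sigma> A"
  then obtain n where n: "n \<ge> 1" and Q: "qno_hom \<sigma> (struct_power \<sigma> n A) A Q"
    by (auto simp: qPol_no_def)
  have dom: "domain A = domain B" using def by (simp add: qno_defines_def)
  have "QH1 \<tau> (struct_power \<tau> n B) B Q"
    unfolding QH1_def
  proof (intro ballI)
    fix R bs cs
    assume R: "R \<in> syms \<tau>" and bs: "bs \<in> rel (struct_power \<tau> n B) R"
      and cs: "cs \<in> tuples (arity \<tau> R) (domain B) - rel B R"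
    define r where "r = arity \<tau> R"
    define S where "S = rel B R"
    let ?S = "single_struct (domain A) S"
    have r: "r \<ge> 1" using \<tau> R by (auto simp: is_signature_def r_def)
    have S: "S \<subseteq> tuples r (domain A)" using B R dom by (auto simp: is_structure_def r_def S_def)
    have fin: "finite (domain A)" using A by (simp add: is_structure_def)
    obtain G :: "('s, nat) rel_structure" and g where "qno_definition \<sigma> A r S G g"
      using def R unfolding qno_defines_def r_def S_def by blast
    then have G: "is_structure \<sigma> G" and g: "\<And>i. i \<in> {1..r} \<Longrightarrow> g i \<in> domain G"
      and noq1: "\<And>P. q_hom (single_sig r) (tuple_struct r) ?S P \<Longrightarrow>
        \<exists>P'. qno_hom \<sigma> G A P' \<and> (\<forall>i\<in>{1..r}. \<forall>a\<in>domain A. qop P' (g i) a = qop P i a)"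
      and noq2: "\<And>P. qno_hom \<sigma> G A P \<Longrightarrow>
        qno_hom (single_sig r) (tuple_struct r) ?S (qfun_pullback r g P)"
      by (auto simp: qno_definition_def)
    have lbs: "length bs = r" and bsn: "\<And>j. j < r \<Longrightarrow> length (bs ! j) = n"
      and rows: "\<And>i. i < n \<Longrightarrow> map (\<lambda>b. b ! i) bs \<in> S"
      using bs by (auto simp: struct_power_def tuples_def r_def S_def dest!: subsetD[OF _ nth_mem])
    have "\<exists>h. struct_hom \<sigma> G A h \<and> (\<forall>j\<in>{1..r}. h (g j) = bs ! (j - 1) ! i)" if i: "i < n" for i
    proof -
      let ?row = "map (\<lambda>b. b ! i) bs"
      let ?P = "classical_qfun {1..r} (domain A) (\<lambda>j. ?row ! (j - 1))"
      have "q_hom (single_sig r) (tuple_struct r) ?S ?P"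
        using q_hom_classical[OF is_structure_tuple_struct is_structure_single_struct[OF fin S]
            struct_hom_tuple_struct[OF rows[OF i] S]]
        by (simp add: tuple_struct_def single_struct_def)
      from noq1[OF this] obtain P' where P': "qno_hom \<sigma> G A P'"
        and eq: "\<And>j a. j \<in> {1..r} \<Longrightarrow> a \<in> domain A \<Longrightarrow> qop P' (g j) a = qop ?P j a"
        by blast
      \<comment> \<open>Equality of operators is all that ties \<open>P'\<close> to
        \<open>?P\<close>, so one actual operator is needed to compare dimensions:
        \<open>r \<ge> 1\<close> provides the vertex \<open>g 1\<close>, and the first entry of the
        row provides the outcome.\<close>
      have "?row ! 0 \<in> set ?row" using lbs r by (intro nth_mem) simp
      then have "?row ! 0 \<in> domain A" using rows[OF i] S unfolding tuples_def by blast
      then have "qop P' (g 1) (?row ! 0) \<in> carrier_mat (hdim P') (hdim P')"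
        using P' g[of 1] r unfolding qno_hom_def quantum_function_def is_PVM_def by simp
      moreover have "qop P' (g 1) (?row ! 0) = qop ?P 1 (?row ! 0)"
        using \<open>?row ! 0 \<in> domain A\<close> r by (intro eq) auto
      moreover have "qop ?P 1 (?row ! 0) \<in> carrier_mat 1 1"
        using \<open>?row ! 0 \<in> domain A\<close> r by (simp add: classical_qfun_def)
      ultimately have "hdim P' = 1" by (metis carrier_matD(1))
      from qno_hom_dim1_classical[OF G fin P' this] obtain h where h: "struct_hom \<sigma> G A h"
        and one: "\<And>v. v \<in> domain G \<Longrightarrow> qop P' v (h v) = 1\<^sub>m 1" by blast
      \<comment> \<open>Were the values different, the operator of \<open>P'\<close> at
        \<open>g j\<close> and \<open>h (g j)\<close> would be 1 by the choice of h and 0 by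
        agreement with \<open>?P\<close>.\<close>
      have "h (g j) = bs ! (j - 1) ! i" if j: "j \<in> {1..r}" for j
      proof (rule ccontr)
        assume ne: "h (g j) \<noteq> bs ! (j - 1) ! i"
        have "h (g j) \<in> domain A" using h g[OF j] by (auto simp: struct_hom_def)
        then have "1\<^sub>m 1 = (of_bool (?row ! (j - 1) = h (g j)) \<cdot>\<^sub>m 1\<^sub>m 1 :: complex mat)"
          using one[OF g[OF j]] eq[OF j, of "h (g j)"] j by (simp add: classical_qfun_def)
        also have "\<dots> = 0\<^sub>m 1 1" using ne j lbs by (auto simp: smult_zero_mat)
        finally have "(0\<^sub>m 1 1 :: complex mat) $$ (0, 0) = 1\<^sub>m 1 $$ (0, 0)" by simp
        then show False by simp
      qed
      with h show ?thesis by blast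
    qed
    then obtain h where h: "\<And>i. i < n \<Longrightarrow> struct_hom \<sigma> G A (h i)"
      and hg: "\<And>i j. i < n \<Longrightarrow> j \<in> {1..r} \<Longrightarrow> h i (g j) = bs ! (j - 1) ! i"
      by metis
    define H where "H v = map (\<lambda>i. h i v) [0..<n]" for v
    \<comment> \<open>The i-th homomorphism sends the distinguished vertices to row i, so together
      they send them to the columns, that is, to the entries of bs.\<close>
    have Hg: "map (H \<circ> g) [1..<Suc r] = bs"
    proof (rule nth_equalityI)
      fix k assume "k < length (map (H \<circ> g) [1..<Suc r])"
      then have k: "k < r" by (simp del: upt_Suc)
      have "H (g (Suc k)) = bs ! k"
        using k bsn hg[of _ "Suc k"] by (intro nth_equalityI) (auto simp: H_def)
      then show "map (H \<circ> g) [1..<Suc r] ! k = bs ! k" using k by (simp del: upt_Suc)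
    qed (use lbs in \<open>simp del: upt_Suc\<close>)
    let ?P = "qfun_comp (domain G) H Q"
    have "qno_hom \<sigma> G A ?P"
      unfolding H_def by (rule qno_hom_comp[OF G struct_hom_power[OF G h] Q])
    from noq2[OF this] have "qprod (qfun_pullback r g ?P) [1..<Suc r] cs =
        0\<^sub>m (hdim (qfun_pullback r g ?P)) (hdim (qfun_pullback r g ?P))"
      using cs dom by (auto simp: qno_hom_def QH1_def single_sig_def single_struct_def tuple_struct_def
          r_def S_def simp del: upt_Suc)
    moreover have "qprod (qfun_pullback r g ?P) [1..<Suc r] cs = qprod Q (map H (map g [1..<Suc r])) cs"
    proof -
      have "set [1..<Suc r] \<subseteq> {1..r}" "set (map g [1..<Suc r]) \<subseteq> domain G" using g by auto
      then show ?thesis unfolding qfun_pullback_eq_comp by (simp only: qprod_comp)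
    qed
    ultimately show "qprod Q bs cs = 0\<^sub>m (hdim Q) (hdim Q)"
      using Hg by (simp add: qfun_comp_def qfun_pullback_def del: upt_Suc)
  qed
  then have "qno_hom \<tau> (struct_power \<tau> n B) B Q"
    using Q dom by (simp add: qno_hom_def struct_power_def)
  then show "Q \<in> qPol_no \<tau> B" using n by (auto simp: qPol_no_def)
qed

section \<open>From inclusion of polymorphisms to gadgets\<close>

lemma struct_hom_trans:
  "struct_hom \<sigma> A B h \<Longrightarrow> struct_hom \<sigma> B C k \<Longrightarrow> struct_hom \<sigma> A C (k \<circ> h)"
  by (fastforce simp: struct_hom_def simp flip: map_map)

lemma struct_hom_proj:
  "i < n \<Longrightarrow> struct_hom \<sigma> (struct_power \<sigma> n A) A (\<lambda>t. t ! i)"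
  by (auto simp: struct_hom_def struct_power_def tuples_def)

text \<open>The unary projection is a polymorphism of A, and a quantum function carries its target,
  which membership in \<open>qPol_no \<tau> B\<close> forces to be the domain of B.\<close>

lemma domain_eq_if_qPol_subset:
  assumes A: "is_structure \<sigma> A" and sub: "qPol_no \<sigma> A \<subseteq> qPol_no \<tau> B"
  shows "domain A = domain B"
proof -
  let ?P = "struct_power \<sigma> 1 A"
  let ?Q = "classical_qfun (domain ?P) (domain A) (\<lambda>t. t ! 0)"
  have "q_hom \<sigma> ?P A ?Q"
    by (rule q_hom_classical[OF is_structure_power[OF A] A struct_hom_proj]) simp
  then have "?Q \<in> qPol_no \<sigma> A" by (auto simp: qPol_no_def q_hom_def qno_hom_def)
  then have "?Q \<in> qPol_no \<tau> B" using sub by blast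
  then have "target ?Q = domain B" by (auto simp: qPol_no_def qno_hom_def quantum_function_def)
  then show ?thesis by (simp add: classical_qfun_def)
qed

text \<open>Measure \<open>E\<close> and apply the classical map \<open>F k\<close> on outcome \<open>k\<close>.\<close>

definition measured_qfun ::
    "'a set \<Rightarrow> 'b set \<Rightarrow> nat \<Rightarrow> 'k set \<Rightarrow> ('k \<Rightarrow> complex mat) \<Rightarrow> ('k \<Rightarrow> 'a \<Rightarrow> 'b) \<Rightarrow> ('a, 'b) qfun" where
  "measured_qfun A B d K E F =
     \<lparr>source = A, target = B, hdim = d,
      qop = (\<lambda>a\<in>A. \<lambda>b\<in>B. coarse_graining d K E (\<lambda>k. F k a) b)\<rparr>"

lemma is_PVM_cong: "(\<And>b. b \<in> B \<Longrightarrow> P b = P' b) \<Longrightarrow> finite B \<Longrightarrow> is_PVM d B P = is_PVM d B P'"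
  using mat_sum_cong[of B P P'] by (simp add: is_PVM_iff_mat_sum)

text \<open>QH1 is tested on each \<open>E k\<close>: there the product is 1 only if
  \<open>F k\<close> maps as to bs, which is impossible for a homomorphism and a bs outside the
  relation.\<close>

lemma qno_hom_measured:
  assumes G: "is_structure \<sigma> G" and A: "is_structure \<sigma> A"
    and E: "is_PVM d K E" and fin: "finite K" and "d > 0"
    and F: "\<And>k. k \<in> K \<Longrightarrow> struct_hom \<sigma> G A (F k)"
  shows "qno_hom \<sigma> G A (measured_qfun (domain G) (domain A) d K E F)"
proof -
  let ?Q = "measured_qfun (domain G) (domain A) d K E F"
  have finA: "finite (domain A)" using A by (simp add: is_structure_def)
  have "is_PVM d (domain A) (\<lambda>b\<in>domain A. coarse_graining d K E (\<lambda>k. F k v) b)" if "v \<in> domain G" for v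
    using is_PVM_coarse_graining[OF E fin finA, of "\<lambda>k. F k v"] F that
    by (subst is_PVM_cong[of _ _ "coarse_graining d K E (\<lambda>k. F k v)"])
      (auto simp: struct_hom_def Pi_iff finA)
  then have "quantum_function (domain G) (domain A) ?Q"
    using \<open>d > 0\<close> by (auto simp: quantum_function_def measured_qfun_def)
  moreover have "QH1 \<sigma> G A ?Q" unfolding QH1_def
  proof (intro ballI)
    fix R as bs assume R: "R \<in> syms \<sigma>" and as: "as \<in> rel G R"
      and bs: "bs \<in> tuples (arity \<sigma> R) (domain A) - rel A R"
    note dom = rel_subset_domain[OF G R as]
    let ?fbs = "zip (map (\<lambda>v k. F k v) as) bs"
    have "set as \<subseteq> domain G" "set bs \<subseteq> domain A" using dom bs by (auto simp: tuples_def)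
    then have "map2 (qop ?Q) as bs = map (\<lambda>(f, b). coarse_graining d K E f b) ?fbs"
      by (induction as bs rule: list_induct2') (auto simp: measured_qfun_def)
    then have prod: "qprod ?Q as bs = foldr (*) (map (\<lambda>(f, b). coarse_graining d K E f b) ?fbs) (1\<^sub>m d)"
      by (simp add: qprod_def measured_qfun_def)
    have "qprod ?Q as bs = 0\<^sub>m d d"
    proof (rule PVM_ext[OF E fin])
      show "qprod ?Q as bs \<in> carrier_mat d d"
        unfolding prod by (rule foldr_mult_carrier) auto
      fix k assume k: "k \<in> K"
      have "map (F k) as \<noteq> bs" using F[OF k] R as bs by (auto simp: struct_hom_def)
      moreover have len: "length bs = length as" using dom bs by (auto simp: tuples_def)
      ultimately obtain i where i: "i < length as" "F k (as ! i) \<noteq> bs ! i"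
        by (metis length_map nth_equalityI nth_map)
      then have "(\<lambda>k. F k (as ! i), bs ! i) \<in> set ?fbs"
        using len by (force simp: in_set_conv_nth)
      then have "(\<forall>(f, b)\<in>set ?fbs. f k = b) \<longleftrightarrow> False"
        using i(2) by (metis (lifting) case_prodD)
      then have "qprod ?Q as bs * E k = of_bool False \<cdot>\<^sub>m E k"
        unfolding prod foldr_coarse_graining_mult[OF E fin k] by (rule arg_cong)
      moreover have "E k \<in> carrier_mat d d" using E k by (auto simp: is_PVM_def)
      ultimately show "qprod ?Q as bs * E k = 0\<^sub>m d d * E k"
        by (simp add: smult_zero_mat)
    qed simp
    then show "qprod ?Q as bs = 0\<^sub>m (hdim ?Q) (hdim ?Q)" by (simp add: measured_qfun_def)
  qed
  ultimately show ?thesis by (simp add: qno_hom_def)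
qed

text \<open>Powers have lists as vertices, gadgets have natural numbers. Homomorphisms both ways
  transport quantum homomorphisms, and the left inverse keeps track of the distinguished
  vertices.\<close>

lemma finite_structure_iso_nat:
  fixes M :: "('s, 'a) rel_structure"
  assumes M: "is_structure \<sigma> M"
  obtains G :: "('s, nat) rel_structure" and \<phi> \<delta> where "is_structure \<sigma> G"
    "struct_hom \<sigma> M G \<phi>" "struct_hom \<sigma> G M \<delta>" "\<And>x. x \<in> domain M \<Longrightarrow> \<delta> (\<phi> x) = x"
proof -
  have "finite (domain M)" using M by (simp add: is_structure_def)
  then obtain \<phi> :: "'a \<Rightarrow> nat" where inj: "inj_on \<phi> (domain M)"
    using finite_imp_inj_to_nat_seg by blast
  define G where "G = \<lparr>domain = \<phi> ` domain M, rel = (\<lambda>R. map \<phi> ` rel M R)\<rparr>"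
  define \<delta> where "\<delta> = inv_into (domain M) \<phi>"
  have \<delta>: "\<delta> (\<phi> x) = x" if "x \<in> domain M" for x
    using inj that by (simp add: \<delta>_def)
  have map\<delta>: "map (\<delta> \<circ> \<phi>) t = t" if "R \<in> syms \<sigma>" "t \<in> rel M R" for R t
    using rel_subset_domain[OF M that] \<delta> by (intro map_idI) auto
  have "is_structure \<sigma> G" using M by (force simp: is_structure_def G_def tuples_def)
  moreover have "struct_hom \<sigma> M G \<phi>" by (auto simp: struct_hom_def G_def)
  moreover have "struct_hom \<sigma> G M \<delta>" using \<delta> map\<delta> by (auto simp: struct_hom_def G_def)
  ultimately show ?thesis using \<delta> that by blast
qed

text \<open>Distinct positions share the single tuple and are adjacent, so QH2 applies. Equal
  positions form no edge of the loopless Gaifman graph; there orthogonality within one PVM is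
  used.\<close>

lemma q_hom_tuple_struct_comm:
  assumes Q: "q_hom (single_sig r) (tuple_struct r) (single_struct A S) Q" and finA: "finite A"
    and ij: "i \<in> {1..r}" "j \<in> {1..r}" and ab: "a \<in> A" "b \<in> A"
  shows "qop Q i a * qop Q j b = qop Q j b * qop Q i a"
proof (cases "i = j")
  case True
  have "is_PVM (hdim Q) A (qop Q i)"
    using Q ij by (auto simp: q_hom_def quantum_function_def tuple_struct_def single_struct_def)
  then show ?thesis
    using True PVM_orthogonal[OF _ finA ab] PVM_orthogonal[OF _ finA ab(2,1)] by (cases "a = b") auto
next
  case False
  then have "{i, j} \<in> gaif_edges (single_sig r) (tuple_struct r)"
    using ij by (force simp: gaif_edges_def single_sig_def tuple_struct_def single_struct_def)
  then show ?thesis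
    using Q ab unfolding q_hom_def QH2_def unfolding single_struct_def rel_structure.simps by blast
qed

text \<open>Nonemptiness of the relation makes the number m of listed tuples positive, so that
  quantum homomorphisms from the m-th power of A are polymorphisms.\<close>

lemma qno_definition_if_qPol_subset:
  fixes \<sigma> :: "'s signature" and A :: "('s, 'a) rel_structure"
    and \<tau> :: "'t signature" and B :: "('t, 'a) rel_structure"
  assumes \<tau>: "is_signature \<tau>" and A: "is_structure \<sigma> A" and B: "is_structure \<tau> B"
    and sub: "qPol_no \<sigma> A \<subseteq> qPol_no \<tau> B"
    and R: "R \<in> syms \<tau>" and ne: "rel B R \<noteq> {}"
  shows "\<exists>(G :: ('s, nat) rel_structure) g. qno_definition \<sigma> A (arity \<tau> R) (rel B R) G g"
proof -
  define r where "r = arity \<tau> R"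
  define S where "S = rel B R"
  let ?xs = "[1..<Suc r]"
  have dom: "domain A = domain B" using domain_eq_if_qPol_subset[OF A sub] .
  have r: "r \<ge> 1" using \<tau> R by (auto simp: is_signature_def r_def)
  have S: "S \<subseteq> tuples r (domain A)" using B R dom by (auto simp: is_structure_def r_def S_def)
  have finA: "finite (domain A)" using A by (simp add: is_structure_def)
  then have finS: "finite S" using S by (rule finite_subset[OF _ finite_tuples, rotated])
  then obtain ss where ss: "set ss = S" using finite_list by blast
  define m where "m = length ss"
  have m: "m \<ge> 1" using ne ss by (cases ss) (auto simp: m_def S_def)
  have "\<forall>s\<in>S. \<exists>i. i < m \<and> ss ! i = s"
    unfolding m_def ss[symmetric] by (simp add: in_set_conv_nth)
  \<comment> \<open>The list may repeat tuples; \<open>pos\<close> fixes for each tuple one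
    coordinate of the power that stands for it.\<close>
  then obtain pos where pos: "\<And>s. s \<in> S \<Longrightarrow> pos s < m \<and> ss ! pos s = s"
    by metis
  let ?P = "struct_power \<sigma> m A"
  obtain G :: "('s, nat) rel_structure" and \<phi> \<delta> where G: "is_structure \<sigma> G"
    and \<phi>: "struct_hom \<sigma> ?P G \<phi>" and \<delta>: "struct_hom \<sigma> G ?P \<delta>"
    and \<delta>\<phi>: "\<And>x. x \<in> domain ?P \<Longrightarrow> \<delta> (\<phi> x) = x"
    using finite_structure_iso_nat[OF is_structure_power[OF A, of m]] by blast
  \<comment> \<open>Column j of the matrix whose rows are the tuples in \<open>ss\<close>; it is a
    vertex of the power.\<close>
  define col where "col j = map (\<lambda>s. s ! (j - 1)) ss" for j :: nat
  define g where "g j = \<phi> (col j)" for j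
  have col: "col j \<in> domain ?P" if "j \<in> {1..r}" for j
  proof -
    have "s ! (j - 1) \<in> domain A" if "s \<in> S" for s
    proof -
      have "length s = r" "set s \<subseteq> domain A" using S that by (auto simp: tuples_def)
      then show ?thesis using \<open>j \<in> {1..r}\<close> nth_mem[of "j - 1" s] by auto
    qed
    then show ?thesis by (auto simp: col_def struct_power_def tuples_def m_def ss)
  qed
  have g: "g j \<in> domain G" if "j \<in> {1..r}" for j
    using \<phi> col[OF that] by (auto simp: g_def struct_hom_def)
  have noq1: "\<exists>Q'. qno_hom \<sigma> G A Q' \<and> (\<forall>i\<in>{1..r}. \<forall>a\<in>domain A. qop Q' (g i) a = qop Q i a)"
    if Q: "q_hom (single_sig r) (tuple_struct r) (single_struct (domain A) S) Q" for Q
  proof -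
    let ?d = "hdim Q"
    let ?J = "joint_PVM ?d (qop Q) ?xs"
    have PVM: "is_PVM ?d (domain A) (qop Q i)" if "i \<in> set ?xs" for i
      using Q that by (auto simp: q_hom_def quantum_function_def tuple_struct_def single_struct_def)
    have comm: "qop Q i a * qop Q j b = qop Q j b * qop Q i a"
      if "i \<in> set ?xs" "j \<in> set ?xs" "a \<in> domain A" "b \<in> domain A" for i j a b
      using that by (intro q_hom_tuple_struct_comm[OF Q finA]) auto
    have S': "S \<subseteq> tuples (length ?xs) (domain A)" using S by (simp del: upt_Suc)
    have J: "is_PVM ?d S ?J"
    proof (rule is_PVM_joint_PVM_supported[OF finA PVM comm S'])
      \<comment> \<open>With the vertices taken in the order 1 to r, the product in QH1 is literally
        the joint operator of the outcome s.\<close>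
      fix s assume "s \<in> tuples (length ?xs) (domain A) - S"
      then have "qprod Q ?xs s = 0\<^sub>m ?d ?d"
        using Q by (auto simp: q_hom_def QH1_def single_sig_def tuple_struct_def single_struct_def
            simp del: upt_Suc)
      then show "?J s = 0\<^sub>m ?d ?d" by (simp add: joint_PVM_def qprod_def)
    qed
    let ?Q' = "measured_qfun (domain G) (domain A) ?d S ?J (\<lambda>s v. \<delta> v ! pos s)"
    have "qno_hom \<sigma> G A ?Q'"
    proof (rule qno_hom_measured[OF G A J finS])
      show "0 < ?d" using Q by (simp add: q_hom_def quantum_function_def)
      show "struct_hom \<sigma> G A (\<lambda>v. \<delta> v ! pos s)" if "s \<in> S" for s
        using struct_hom_trans[OF \<delta> struct_hom_proj] pos[OF that] by (simp add: comp_def)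
    qed
    moreover have "qop ?Q' (g i) a = qop Q i a" if i: "i \<in> {1..r}" and a: "a \<in> domain A" for i a
    proof -
      \<comment> \<open>Coordinate \<open>pos s\<close> of column i is \<open>s ! (i - 1)\<close>,
        so at \<open>g i\<close> the measured function is the i-th marginal of the joint
        PVM.\<close>
      have "{s \<in> S. \<delta> (g i) ! pos s = a} = {s \<in> S. s ! (i - 1) = a}"
        using pos by (auto simp: g_def \<delta>\<phi>[OF col[OF i]]) (auto simp: col_def m_def)
      then have "qop ?Q' (g i) a = coarse_graining ?d S ?J (\<lambda>s. s ! (i - 1)) a"
        using g[OF i] a by (simp add: measured_qfun_def coarse_graining_def del: upt_Suc)
      also have "\<dots> = qop Q (?xs ! (i - 1)) a"
        using i a by (intro coarse_graining_joint_PVM[OF finA PVM comm S' J]) auto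
      also have "?xs ! (i - 1) = i" using i by (simp del: upt_Suc)
      finally show ?thesis .
    qed
    ultimately show ?thesis by blast
  qed
  have noq2: "qno_hom (single_sig r) (tuple_struct r) (single_struct (domain A) S) (qfun_pullback r g Q)"
    if Q: "qno_hom \<sigma> G A Q" for Q
  proof -
    let ?Q' = "qfun_comp (domain ?P) \<phi> Q"
    have "?Q' \<in> qPol_no \<sigma> A"
      using qno_hom_comp[OF is_structure_power[OF A] \<phi> Q] m by (auto simp: qPol_no_def)
    then have "?Q' \<in> qPol_no \<tau> B" using sub by blast
    then obtain n where n: "qno_hom \<tau> (struct_power \<tau> n B) B ?Q'"
      by (auto simp: qPol_no_def)
    \<comment> \<open>The inclusion only provides some arity n. The sources agree, and a common
      element, the column \<open>col 1\<close> available since \<open>r \<ge> 1\<close>, has length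
      both m and n.\<close>
    have "tuples m (domain A) = tuples n (domain A)"
      using n dom by (simp add: qno_hom_def quantum_function_def qfun_comp_def struct_power_def)
    moreover have "col 1 \<in> tuples m (domain A)" using col[of 1] r by (simp add: struct_power_def)
    ultimately have "n = m" by (auto simp: tuples_def)
    \<comment> \<open>Reading the columns row by row returns the listed tuples of S; this is what
      puts the columns into the relation of the power of B.\<close>
    have "map (\<lambda>b. b ! i) (map col ?xs) \<in> S" if i: "i < m" for i
    proof -
      have "ss ! i \<in> S" using i ss by (auto simp: m_def)
      then have "length (ss ! i) = r" using S by (auto simp: tuples_def)
      then have "map (\<lambda>b. b ! i) (map col ?xs) = ss ! i"
        using i by (intro nth_equalityI) (auto simp: col_def m_def simp del: upt_Suc)
      with \<open>ss ! i \<in> S\<close> show ?thesis by simp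
    qed
    moreover have "map col ?xs \<in> tuples r (tuples m (domain B))"
      using col by (auto simp: tuples_def[of r] struct_power_def dom simp del: upt_Suc)
    ultimately have cols: "map col ?xs \<in> rel (struct_power \<tau> m B) R"
      by (simp add: struct_power_def r_def S_def del: upt_Suc)
    have "qprod (qfun_pullback r g Q) ?xs cs = 0\<^sub>m (hdim Q) (hdim Q)"
      if "cs \<in> tuples r (domain A) - S" for cs
    proof -
      have "qprod ?Q' (map col ?xs) cs = 0\<^sub>m (hdim Q) (hdim Q)"
        using n cols R that dom
        by (auto simp: qno_hom_def QH1_def r_def S_def \<open>n = m\<close> qfun_comp_def simp del: upt_Suc)
      moreover have "qprod ?Q' (map col ?xs) cs = qprod Q (map \<phi> (map col ?xs)) cs"
        using col by (intro qprod_comp) (auto simp del: upt_Suc)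
      moreover have "qprod (qfun_pullback r g Q) ?xs cs = qprod Q (map g ?xs) cs"
        unfolding qfun_pullback_eq_comp by (intro qprod_comp) auto
      moreover have "map \<phi> (map col ?xs) = map g ?xs" by (simp add: g_def del: upt_Suc)
      ultimately show ?thesis by metis
    qed
    moreover have "quantum_function {1..r} (domain A) (qfun_pullback r g Q)"
      unfolding qfun_pullback_eq_comp using Q g
      by (intro quantum_function_comp[of "domain G"]) (auto simp: qno_hom_def)
    ultimately show ?thesis
      by (simp add: qno_hom_def QH1_def single_sig_def tuple_struct_def single_struct_def
          qfun_pullback_def del: upt_Suc)
  qed
  have "qno_definition \<sigma> A r S G g"
    unfolding qno_definition_def using G g noq1 noq2 by blast
  then show ?thesis unfolding r_def S_def by blast
qed

theorem theorem13:
  fixes \<sigma> :: "'s signature" and A :: "('s, 'a) rel_structure"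
    and \<tau> :: "'t signature" and B :: "('t, 'a) rel_structure"
  assumes "is_signature \<sigma>" and "is_structure \<sigma> A"
    and "is_signature \<tau>" and "is_structure \<tau> B"
  shows "((\<forall>R\<in>syms \<tau>. rel B R \<noteq> {}) \<longrightarrow>
            (qPol_no \<sigma> A \<subseteq> qPol_no \<tau> B \<longleftrightarrow> qno_defines \<sigma> A \<tau> B))
       \<and> (qno_defines \<sigma> A \<tau> B \<longrightarrow> qPol_no \<sigma> A \<subseteq> qPol_no \<tau> B)"
proof -
  have "qno_defines \<sigma> A \<tau> B \<Longrightarrow> qPol_no \<sigma> A \<subseteq> qPol_no \<tau> B"
    by (rule qPol_subset_if_qno_defines[OF assms(3,2,4)])
  moreover have "qno_defines \<sigma> A \<tau> B"
    if "\<forall>R\<in>syms \<tau>. rel B R \<noteq> {}" "qPol_no \<sigma> A \<subseteq> qPol_no \<tau> B"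
    unfolding qno_defines_def
    using domain_eq_if_qPol_subset[OF assms(2) that(2)] that(1)
      qno_definition_if_qPol_subset[OF assms(3,2,4) that(2)] by blast
  ultimately show ?thesis by blast
qed

end
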